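(* Let $m\ge 2$ be an integer and $n$ an even positive integer. A cyclic $\ell$-cycle system of $K_{m\times n}$ does not exist in each of the following cases: (a) $m\equiv 0\pmod 4$ and $|\ell|_2=|m|_2+2|n|_2-1$; (b) $m\equiv 1\pmod 4$ and $|\ell|_2=|m-1|_2+2|n|_2-1$; (c) $m\equiv 2,3\pmod 4$, $n\equiv 2\pmod 4$ and $\ell\not\equiv 0\pmod 4$; (d) $m\equiv 2,3\pmod 4$, $n\equiv 0\pmod 4$ and $|\ell|_2=2|n|_2$.
   Context: $K_{m\times n}$ is the complete multipartite graph with $m$ parts of size $n$, with vertex set identified with $\mathbb{Z}_{mn}$, parts the cosets of $m\mathbb{Z}_{mn}$, and $x,y$ adjacent iff $x-y\notin m\mathbb{Z}_{mn}$. An $\ell$-cycle system is a set of cycles of length $\ell$ whose edge sets partition the edge set; it is cyclic if whenever $(c_0,\dots,c_{\ell-1})$ belongs to it, so does $(c_0+1,\dots,c_{\ell-1}+1)$. For a positive integer $x$, $|x|_2$ denotes the largest $e$ such that $2^e$ divides $x$. *)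

theory Defs
  imports
    "HOL-Library.Disjoint_Sets"
    "HOL-Computational_Algebra.Primes"
    "HOL-Number_Theory.Cong"
begin

text \<open>
  The group of integers modulo \<open>N\<close> is represented by the residues \<open>{0..<int N}\<close> with
  arithmetic modulo \<open>N\<close>; undirected edges are two-element sets of vertices.
\<close>

definition multipartite_verts :: "nat \<Rightarrow> nat \<Rightarrow> int set" where
  "multipartite_verts m n = {0..<int (m * n)}"

text \<open>
  As \<open>m\<close> divides \<open>m * n\<close>, the class of \<open>x - y\<close> modulo \<open>m * n\<close> lies in the subgroup
  generated by \<open>m\<close> iff the integer \<open>x - y\<close> is a multiple of \<open>m\<close>.
\<close>

definition multipartite_edges :: "nat \<Rightarrow> nat \<Rightarrow> int set set" where
  "multipartite_edges m n =
     {{x, y} | x y. x \<in> multipartite_verts m n \<and> y \<in> multipartite_verts m n \<and>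
                    \<not> int m dvd x - y}"

definition cycle_seq :: "'a list \<Rightarrow> bool" where
  "cycle_seq c \<longleftrightarrow> 3 \<le> length c \<and> distinct c"

definition cycle_edges :: "'a list \<Rightarrow> 'a set set" where
  "cycle_edges c = {{c ! i, c ! (Suc i mod length c)} | i. i < length c}"

text \<open>
  The sequences \<open>c\<close> and \<open>c'\<close> denote the same cycle iff they agree up to rotation and
  reversal, i.e. iff \<open>cycle_edges c = cycle_edges c'\<close>. A cycle, as a graph, is therefore
  represented by its edge set, and a set of cycles by a set of such edge sets.
\<close>

definition cycle_system :: "nat \<Rightarrow> 'a set set \<Rightarrow> 'a set set set \<Rightarrow> bool" where
  "cycle_system l E \<C> \<longleftrightarrow>
     (\<forall>B\<in>\<C>. \<exists>c. cycle_seq c \<and> length c = l \<and> B = cycle_edges c) \<and> partition_on E \<C>"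

definition cyclic_cycle_system :: "nat \<Rightarrow> nat \<Rightarrow> nat \<Rightarrow> int set set set \<Rightarrow> bool" where
  "cyclic_cycle_system l m n \<C> \<longleftrightarrow>
     cycle_system l (multipartite_edges m n) \<C> \<and>
     (\<forall>c. cycle_seq c \<and> cycle_edges c \<in> \<C> \<longrightarrow>
          cycle_edges (map (\<lambda>x. (x + 1) mod int (m * n)) c) \<in> \<C>)"

end

theory Submission
  imports Defs "HOL-Combinatorics.Cycles"
begin

text \<open>
  Let \<open>N = m n\<close>, let \<open>2\<^sup>a\<close> be the exact power of two dividing \<open>N\<close>, and call an edge odd if the
  difference of its ends is odd. The 2-part of the translation group, of order \<open>2\<^sup>a\<close>, permutes the
  cycles of a cyclic system. As \<open>n\<close> is even, \<open>N / 2\<close> is a multiple of \<open>m\<close>, hence not the difference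
  of an edge; so a nontrivial translation fixing a cycle rotates it and cannot reflect it. A cycle
  with stabilizer of order \<open>2\<^sup>j\<close> thus consists of \<open>2\<^sup>j\<close> copies of a path whose ends differ by an odd
  multiple of \<open>N / 2\<^sup>j\<close>, and its number of odd edges is congruent to \<open>N\<close> modulo \<open>2\<^sup>j\<^sup>+\<^sup>1\<close>. Summing over
  orbits, the total number of odd edges is congruent to \<open>2\<^sup>a\<close> times the number of cycles modulo
  \<open>2\<^sup>a\<^sup>+\<^sup>1\<close>. Both numbers are known from \<open>l\<close>, \<open>m\<close> and \<open>n\<close>, and in each of the four cases the congruence
  fails.
\<close>

section \<open>Orbit sums under a permutation of 2-power order\<close>

text \<open>Each orbit has 2^i elements for some i with i at most \<open>a\<close>, and
  \<open>w\<close> is constant on it, so it contributes 2^i times a single weight. The last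
  hypothesis supplies the missing factor 2^(a - i + 1). Orbits are split off one at a time.\<close>

lemma two_power_dvd_sum_orbits:
  fixes w :: "'a \<Rightarrow> int"
  assumes "finite X" and "\<And>x. x \<in> X \<Longrightarrow> \<phi> x \<in> X"
    and "\<And>x. x \<in> X \<Longrightarrow> (\<phi> ^^ (2 ^ a)) x = x"
    and "\<And>x. x \<in> X \<Longrightarrow> w (\<phi> x) = w x"
    and "\<And>x i. x \<in> X \<Longrightarrow> i \<le> a \<Longrightarrow> (\<phi> ^^ (2 ^ i)) x = x \<Longrightarrow> 2 ^ (a - i + 1) dvd w x"
  shows "2 ^ (a + 1) dvd sum w X"
  using assms
proof (induction X rule: finite_psubset_induct)
  case (psubset X)
  show ?case
  proof (cases "X = {}")
    case False
    then obtain x where x: "x \<in> X" by blast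
    define p where "p = least_power \<phi> x"
    have per: "(\<phi> ^^ (2 ^ a)) x = x" by (rule psubset.prems(2)[OF x])
    have p: "(\<phi> ^^ p) x = x" "p > 0"
      using least_powerI[OF per] unfolding p_def by auto
    have "p dvd 2 ^ a"
      using least_power_minimal[OF per] unfolding p_def .
    then obtain i where i: "i \<le> a" "p = 2 ^ i"
      by (auto simp: divides_primepow_nat)
    define Q where "Q = (\<lambda>k. (\<phi> ^^ k) x) ` {..<p}"
    have inQ: "(\<phi> ^^ k) x \<in> Q" for k
      unfolding Q_def using funpow_mod_eq[OF p(1), of k] p(2)
      by (metis imageI lessThan_iff mod_less_divisor)
    have inX: "(\<phi> ^^ k) x \<in> X" for k
      by (induction k) (auto intro: x psubset.prems(1))
    have w: "w ((\<phi> ^^ k) x) = w x" for k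
      by (induction k) (auto simp: inX psubset.prems(3))
    \<comment> \<open>A coincidence within one period would give the shorter period p - c +
      b.\<close>
    have no: "(\<phi> ^^ b) x \<noteq> (\<phi> ^^ c) x" if "b < c" "c < p" for b c
    proof
      assume eq: "(\<phi> ^^ b) x = (\<phi> ^^ c) x"
      have "(\<phi> ^^ (p - c + b)) x = (\<phi> ^^ (p - c)) ((\<phi> ^^ b) x)" by (simp add: funpow_add)
      also have "\<dots> = (\<phi> ^^ (p - c + c)) x" using eq by (simp add: funpow_add)
      also have "\<dots> = x" using that p by simp
      finally have "p \<le> p - c + b"
        unfolding p_def using that p_def by (intro least_power_le) auto
      then show False using that by simp
    qed
    then have "inj_on (\<lambda>k. (\<phi> ^^ k) x) {..<p}"
      by (auto simp: inj_on_def) (metis linorder_neqE_nat)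
    then have "sum w Q = int p * w x"
      unfolding Q_def by (simp add: sum.reindex w)
    moreover have "2 ^ (a - i + 1) dvd w x"
      using psubset.prems(4)[OF x i(1)] p(1) i(2) by simp
    then have "2 ^ i * 2 ^ (a - i + 1) dvd int p * w x"
      using i(2) by (intro mult_dvd_mono) auto
    moreover have "2 ^ i * 2 ^ (a - i + 1) = (2 ^ (a + 1) :: int)"
      using i(1) by (simp flip: power_add)
    ultimately have 1: "2 ^ (a + 1) dvd sum w Q" by metis
    have QX: "Q \<subseteq> X" "x \<in> Q" using inX inQ[of 0] by (auto simp: Q_def)
    have "2 ^ (a + 1) dvd sum w (X - Q)"
    proof (rule psubset.IH)
      show "X - Q \<subset> X" using QX by blast
    next
      fix y assume y: "y \<in> X - Q"
      \<comment> \<open>From an image in \<open>Q\<close>, another 2^a - 1 steps lead back to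
        \<open>y\<close> without leaving \<open>Q\<close>. So the complement of the orbit is
        invariant too.\<close>
      have "\<phi> y \<notin> Q"
      proof
        assume "\<phi> y \<in> Q"
        then obtain k where "\<phi> y = (\<phi> ^^ k) x" by (auto simp: Q_def)
        then have "(\<phi> ^^ (2 ^ a - 1)) (\<phi> y) \<in> Q"
          using inQ[of "2 ^ a - 1 + k"] unfolding funpow_add by simp
        moreover have "(\<phi> ^^ (2 ^ a - 1)) (\<phi> y) = (\<phi> ^^ Suc (2 ^ a - 1)) y"
          by (metis comp_apply funpow_Suc_right)
        ultimately show False using psubset.prems(2)[of y] y by simp
      qed
      then show "\<phi> y \<in> X - Q" using psubset.prems(1) y by blast
    qed (use psubset.prems in auto)
    then have "2 ^ (a + 1) dvd sum w (X - Q) + sum w Q" using 1 by (rule dvd_add)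
    then show ?thesis using sum.subset_diff[OF QX(1) psubset.hyps, of w] by simp
  qed simp
qed

section \<open>Cycles as periodic functions\<close>

text \<open>A cycle is read as an \<open>l\<close>-periodic function on the integers, so that rotations and
  reflections of a cycle become \<open>i \<mapsto> i + r\<close> and \<open>i \<mapsto> r - i\<close>.\<close>

lemma cycle_automorphism:
  fixes f g :: "int \<Rightarrow> 'a" and l :: int
  assumes l: "l \<ge> 3"
    and f: "\<And>i j. f i = f j \<longleftrightarrow> l dvd i - j"
    and g: "\<And>i j. g i = g j \<longleftrightarrow> l dvd i - j"
    and edge: "\<And>i. \<exists>k. {g i, g (i + 1)} = {f k, f (k + 1)}"
  obtains r where "\<And>i. g i = f (i + r)" | r where "\<And>i. g i = f (r - i)"
proof -
  have step: "g (i + 1) = f (k + 1) \<or> g (i + 1) = f (k - 1)" if gk: "g i = f k" for i k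
  proof -
    obtain k' where "{g i, g (i + 1)} = {f k', f (k' + 1)}" using edge by blast
    then consider "f k = f k'" "g (i + 1) = f (k' + 1)" | "f k = f (k' + 1)" "g (i + 1) = f k'"
      using gk by (auto simp: doubleton_eq_iff)
    then show ?thesis
    proof cases
      case 1
      then have "f (k + 1) = f (k' + 1)" using f by simp
      then show ?thesis using 1 by simp
    next
      case 2
      then have "f (k - 1) = f k'" using f by (simp add: algebra_simps)
      then show ?thesis using 2 by simp
    qed
  qed
  obtain r where r: "g 0 = f r" using edge[of 0] by (auto simp: doubleton_eq_iff)
  \<comment> \<open>The sign \<open>e\<close> is the direction of the first step: 1 leads to a
    rotation, -1 to a reflection.\<close>
  then obtain e :: int where e: "e = 1 \<or> e = - 1" and "g 1 = f (r + e)"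
    using step[of 0 r] by (metis add_0 diff_conv_add_uminus)
  \<comment> \<open>Two consecutive values are carried along so that the direction persists: turning
    back would give g (n + 2) = g n, but \<open>l\<close> does not divide 2.\<close>
  have "g (int n) = f (r + e * int n) \<and> g (int n + 1) = f (r + e * (int n + 1))" for n
  proof (induction n)
    case (Suc n)
    have "\<not> l dvd 2" using l by (simp add: zdvd_not_zless)
    then have "g (int n + 1 + 1) \<noteq> f (r + e * int n)"
      using Suc g[of "int n + 1 + 1" "int n"] by auto
    moreover have "r + e * (int n + 1) - e = r + e * int n"
      by (simp add: algebra_simps)
    ultimately have "g (int n + 1 + 1) = f (r + e * (int n + 1) + e)"
      using step[of "int n + 1" "r + e * (int n + 1)"] Suc e by auto
    then show ?case using Suc by (simp add: algebra_simps)
  qed (use r \<open>g 1 = f (r + e)\<close> in auto)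
  note nat = this
  \<comment> \<open>Periodicity of both functions extends the formula to negative arguments.\<close>
  have "g i = f (r + e * i)" for i
  proof -
    have "g i = g (i mod l)" using g by (simp add: mod_eq_dvd_iff[symmetric])
    also have "\<dots> = f (r + e * (i mod l))" using nat[of "nat (i mod l)"] l by simp
    also have "l dvd e * (i mod l - i)" by (simp add: mod_eq_dvd_iff[symmetric])
    then have "f (r + e * (i mod l)) = f (r + e * i)" using f by (simp add: algebra_simps)
    finally show ?thesis .
  qed
  then show ?thesis using e that by (auto simp: algebra_simps)
qed

text \<open>Lets a sum over a common multiple of two periods be evaluated by either period.\<close>

lemma sum_periodic:
  fixes w :: "nat \<Rightarrow> int"
  assumes "\<And>i. w (i + p) = w i"
  shows "(\<Sum>i<k * p. w i) = int k * (\<Sum>i<p. w i)"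
proof (induction k)
  case (Suc k)
  have per: "w (i + k * p) = w i" for i k
    by (induction k) (auto simp: assms add.assoc[symmetric] add.commute[of p])
  have "(\<Sum>i<q + r. w i) = (\<Sum>i<q. w i) + (\<Sum>i<r. w (i + q))" for q r
    by (induction r) (simp_all add: add.commute)
  from this[of "k * p" p] show ?case using Suc per by (simp add: algebra_simps)
qed simp

text \<open>Modulo 2 the indicator of an odd step equals the step itself, so the sum
  telescopes.\<close>

lemma sum_odd_steps_cong:
  fixes f :: "nat \<Rightarrow> int"
  shows "[(\<Sum>i<n. of_bool (odd (f (Suc i) - f i))) = f n - f 0] (mod 2)"
  by (induction n) (auto simp: cong_iff_dvd_diff)

definition cyc :: "'a list \<Rightarrow> int \<Rightarrow> 'a" where
  "cyc c i = c ! nat (i mod int (length c))"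

lemma cyc_eq_iff:
  assumes "cycle_seq c"
  shows "cyc c i = cyc c j \<longleftrightarrow> int (length c) dvd i - j"
proof -
  have l: "0 < int (length c)" and d: "distinct c"
    using assms unfolding cycle_seq_def by auto
  have "cyc c i = cyc c j \<longleftrightarrow> nat (i mod int (length c)) = nat (j mod int (length c))"
    unfolding cyc_def using l d by (intro nth_eq_iff_index_eq) (auto simp: nat_less_iff)
  also have "\<dots> \<longleftrightarrow> i mod int (length c) = j mod int (length c)"
    using l by (intro eq_nat_nat_iff) auto
  finally show ?thesis by (simp add: mod_eq_dvd_iff)
qed

lemma cyc_mod: "cyc c (i mod int (length c)) = cyc c i"
  by (simp add: cyc_def)

lemma cycle_edges_cyc: "cycle_edges c = (\<lambda>i. {cyc c (int i), cyc c (int i + 1)}) ` {..<length c}"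
proof -
  have "c ! i = cyc c (int i)" "c ! (Suc i mod length c) = cyc c (int i + 1)" if "i < length c" for i
    using that by (auto simp: cyc_def zmod_int nat_mod_distrib)
       (metis Suc_as_int nat_int zmod_int)
  then have "{c ! i, c ! (Suc i mod length c)} = {cyc c (int i), cyc c (int i + 1)}"
    if "i < length c" for i using that by simp
  moreover have "cycle_edges c = (\<lambda>i. {c ! i, c ! (Suc i mod length c)}) ` {..<length c}"
    unfolding cycle_edges_def by auto
  ultimately show ?thesis by (simp cong: image_cong_simp)
qed

lemma cyc_edge_in:
  assumes "cycle_seq c"
  shows "{cyc c i, cyc c (i + 1)} \<in> cycle_edges c"
proof -
  have l: "0 < int (length c)" using assms unfolding cycle_seq_def by auto
  have "cyc c (i mod int (length c) + 1) = cyc c (i + 1)"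
    by (metis cyc_mod mod_add_left_eq)
  then have "{cyc c i, cyc c (i + 1)} =
      (\<lambda>i. {cyc c (int i), cyc c (int i + 1)}) (nat (i mod int (length c)))"
    using l by (simp add: cyc_mod)
  moreover have "nat (i mod int (length c)) < length c" using l by (simp add: nat_less_iff)
  ultimately show ?thesis unfolding cycle_edges_cyc by blast
qed

lemma inj_on_cyc_edge:
  assumes "cycle_seq c"
  shows "inj_on (\<lambda>i. {cyc c (int i), cyc c (int i + 1)}) {..<length c}"
proof (rule inj_onI)
  fix i j
  assume i: "i \<in> {..<length c}" and j: "j \<in> {..<length c}"
    and eq: "{cyc c (int i), cyc c (int i + 1)} = {cyc c (int j), cyc c (int j + 1)}"
  have l: "length c \<ge> 3" using assms by (simp add: cycle_seq_def)
  \<comment> \<open>If two edges agreed with their ends swapped, \<open>length c\<close> would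
    divide 2, but it is at least 3.\<close>
  have "\<not> (int (length c) dvd int i - (int j + 1) \<and> int (length c) dvd int i + 1 - int j)"
  proof
    assume "int (length c) dvd int i - (int j + 1) \<and> int (length c) dvd int i + 1 - int j"
    then have "int (length c) dvd (int i + 1 - int j) - (int i - (int j + 1))"
      using dvd_diff by blast
    then have "int (length c) dvd 2" by simp
    then show False using l by (simp add: zdvd_not_zless)
  qed
  then have "int (length c) dvd int i - int j"
    using eq by (auto simp: doubleton_eq_iff cyc_eq_iff[OF assms])
  then have "int i mod int (length c) = int j mod int (length c)"
    by (simp add: mod_eq_dvd_iff)
  then show "i = j" using i j by simp
qed

lemma card_cycle_edges:
  assumes "cycle_seq c"
  shows "card (cycle_edges c) = length c"
  unfolding cycle_edges_cyc by (simp add: card_image inj_on_cyc_edge[OF assms])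

section \<open>Odd edges of a cycle fixed by a translation\<close>

text \<open>As \<open>x \<noteq> y\<close>, for an edge \<open>{x, y}\<close> the parity of \<open>\<Sum>{x, y}\<close> is that of the difference \<open>x - y\<close>.\<close>

definition odd_edges :: "int set set \<Rightarrow> int set set" where
  "odd_edges B = {e \<in> B. odd (\<Sum>e)}"

definition translate :: "nat \<Rightarrow> int \<Rightarrow> int set \<Rightarrow> int set" where
  "translate N t e = (\<lambda>x. (x + t) mod int N) ` e"

lemma card_odd_edges_cycle:
  assumes "cycle_seq c"
  shows "int (card (odd_edges (cycle_edges c))) =
    (\<Sum>i<length c. of_bool (odd (cyc c (int (Suc i)) - cyc c (int i))))"
proof -
  let ?e = "\<lambda>i. {cyc c (int i), cyc c (int i + 1)}"
  have l: "length c \<ge> 3" using assms by (simp add: cycle_seq_def)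
  have ne: "cyc c (int i) \<noteq> cyc c (int i + 1)" for i
    using l by (simp add: cyc_eq_iff[OF assms] zdvd_not_zless)
  have "odd_edges (cycle_edges c) = ?e ` {i \<in> {..<length c}. odd (\<Sum>(?e i))}"
    unfolding odd_edges_def cycle_edges_cyc by blast
  moreover have "inj_on ?e {i \<in> {..<length c}. odd (\<Sum>(?e i))}"
    using inj_on_cyc_edge[OF assms] by (rule inj_on_subset) auto
  ultimately have "int (card (odd_edges (cycle_edges c))) =
      (\<Sum>i\<in>{i \<in> {..<length c}. odd (\<Sum>(?e i))}. 1)"
    by (simp add: card_image)
  also have "\<dots> = (\<Sum>i<length c. of_bool (odd (\<Sum>(?e i))))"
    unfolding of_bool_def by (rule sum.inter_filter) simp
  also have "\<dots> = (\<Sum>i<length c. of_bool (odd (cyc c (int (Suc i)) - cyc c (int i))))"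
    using ne by (intro sum.cong) (auto simp: add.commute)
  finally show ?thesis .
qed

text \<open>For positive \<open>j\<close> the translation by t = N / 2^j rotates the cycle by
  \<open>q\<close> positions, and 2^j such rotations wind around it \<open>u\<close> times with
  \<open>u\<close> odd. Counting odd edges along this closed walk in two ways gives 2^j R = u S.
  Here \<open>R\<close> counts a path whose ends differ by \<open>t\<close> modulo N, so it has the
  parity of \<open>t\<close>. Hence \<open>S\<close> is 2^j times a number of the parity of
  \<open>t\<close>, and 2^j t = N.\<close>

lemma translate_fixed_cycle_cong:
  fixes c :: "int list" and N j :: nat
  assumes c: "cycle_seq c" "set c \<subseteq> {0..<int N}"
    and N: "even N" "2 ^ j dvd N" "N > 0"
    and half: "\<And>x y. {x, y} \<in> cycle_edges c \<Longrightarrow> \<not> [x - y = int N div 2] (mod int N)"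
    and fixed: "translate N (int (N div 2 ^ j)) ` cycle_edges c \<subseteq> cycle_edges c"
  shows "[int (card (odd_edges (cycle_edges c))) = int N] (mod 2 ^ (j + 1))"
proof -
  define l where "l = length c"
  define f where "f = cyc c"
  define t where "t = int (N div 2 ^ j)"
  define w :: "nat \<Rightarrow> int" where "w i = of_bool (odd (f (int (Suc i)) - f (int i)))" for i
  define S where "S = (\<Sum>i<l. w i)"
  have l: "l \<ge> 3" using c(1) by (simp add: cycle_seq_def l_def)
  have feq: "f i = f j \<longleftrightarrow> int l dvd i - j" for i j
    unfolding f_def l_def by (rule cyc_eq_iff[OF c(1)])
  have frange: "0 \<le> f i" "f i < int N" for i
  proof -
    have "0 < int (length c)" using l unfolding l_def by linarith
    then have "f i \<in> set c"
      unfolding f_def cyc_def by (intro nth_mem) (auto simp: nat_less_iff)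
    then show "0 \<le> f i" "f i < int N" using c(2) by auto
  qed
  have inj: "f i = f j" if "[f i = f j] (mod int N)" for i j
    using that frange by (simp add: cong_def)
  have card: "int (card (odd_edges (cycle_edges c))) = S"
    unfolding S_def w_def f_def l_def by (rule card_odd_edges_cycle[OF c(1)])
  have tN: "2 ^ j * t = int N" unfolding t_def using N(2)
    by (metis dvd_mult_div_cancel of_nat_mult of_nat_numeral of_nat_power)
  have parity: "[(\<Sum>i<n. w i) = f (int n) - f 0] (mod 2)" for n
    using sum_odd_steps_cong[of "\<lambda>i. f (int i)" n] unfolding w_def by simp
  show ?thesis
  proof (cases "j = 0")
    case True
    \<comment> \<open>Here only parity matters: a closed walk has an even number of odd steps, and N
      is even.\<close>
    have "f (int l) = f 0" using feq by simp
    then show ?thesis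
      using True parity[of l] N(1) unfolding card S_def[symmetric] by (simp add: cong_def)
  next
    case False
    then obtain j' where j': "j = Suc j'" by (cases j) auto
    have tpos: "0 < t" using tN N(3) by (cases "t \<le> 0") (auto simp: t_def)
    have half_t: "int N div 2 = 2 ^ j' * t" using tN j' by auto
    define g where "g i = (f i + t) mod int N" for i
    have geq: "g i = g k \<longleftrightarrow> int l dvd i - k" for i k
    proof -
      have "g i = g k \<longleftrightarrow> [f i = f k] (mod int N)"
        unfolding g_def by (metis cong_def cong_add_rcancel)
      then show ?thesis using inj feq by (metis cong_refl)
    qed
    have edge: "\<exists>k. {g i, g (i + 1)} = {f k, f (k + 1)}" for i
    proof -
      have "translate N t {f i, f (i + 1)} \<in> cycle_edges c"
        using fixed cyc_edge_in[OF c(1), of i] unfolding t_def f_def by blast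
      then have "{g i, g (i + 1)} \<in> cycle_edges c" by (simp add: translate_def g_def)
      then show ?thesis unfolding cycle_edges_cyc f_def by auto
    qed
    have fg: "[g i = f i + t] (mod int N)" for i unfolding g_def by simp
    obtain r where r: "\<And>i. g i = f (i + r)"
    proof (rule cycle_automorphism[where f = f and g = g and l = "int l"])
      \<comment> \<open>A reflection is an involution, so N divides 2 t. As N = 2^j t with
        \<open>j\<close> positive, this leaves j = 1 and t = N / 2.\<close>
      fix r assume refl: "\<And>i. g i = f (r - i)"
      have "[f r = f (r - r) + t] (mod int N)" using fg[of 0] refl[of 0] by simp
      moreover have "[f (r - r) = f r + t] (mod int N)" using fg[of r] refl[of r] by simp
      ultimately have "[f r + f (r - r) = (f (r - r) + t) + (f r + t)] (mod int N)"
        by (rule cong_add)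
      then have "int N dvd (f r + f (r - r)) - ((f (r - r) + t) + (f r + t))"
        by (simp only: cong_iff_dvd_diff)
      then have N2: "int N dvd 2 * t" by (simp add: dvd_minus_iff[of _ "- (2 * t)", symmetric])
      then have "2 ^ j * t dvd 2 * t" using tN by simp
      then have "(2 :: int) ^ j dvd 2" using tpos by simp
      then have "(2 :: int) ^ j \<le> 2 ^ 1" by (simp add: zdvd_imp_le)
      then have "j \<le> 1" by (simp only: power_increasing_iff one_less_numeral_iff semiring_norm)
      then have "j' = 0" using j' by simp
      then have tN2: "t = int N div 2" using half_t by simp
      show thesis
      \<comment> \<open>For even \<open>r\<close> the reflection fixes the vertex at position r / 2,
        impossible for a translation by N / 2. For odd \<open>r\<close> it swaps the ends of an
        edge, which would then differ by N / 2, against \<open>half\<close>.\<close>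
      proof (cases "even r")
        case True
        then obtain q where "r = 2 * q" by blast
        then have "[f q = f q + t] (mod int N)" using fg[of q] refl[of q] by simp
        then have "int N dvd t" by (simp add: cong_iff_dvd_diff)
        then show thesis using tpos tN2 N(3) zdvd_imp_le by fastforce
      next
        case False
        then obtain q where q: "r = 2 * q + 1" by (elim oddE)
        then have "[f (q + 1) = f q + t] (mod int N)" using fg[of q] refl[of q] by simp
        then have "[f (q + 1) - f q = int N div 2] (mod int N)"
          using tN2 by (simp add: cong_iff_dvd_diff algebra_simps)
        moreover have "{f (q + 1), f q} \<in> cycle_edges c"
          using cyc_edge_in[OF c(1), of q] by (simp add: f_def insert_commute)
        ultimately show thesis using half by blast
      qed
    qed (use l feq geq edge in auto)
    define q where "q = nat (r mod int l)"
    have q: "g i = f (i + int q)" for i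
    proof -
      have "f (i + r mod int l) = f (i + r)"
        using feq by (simp add: mod_eq_dvd_iff[symmetric] mod_add_right_eq)
      then show ?thesis using r l by (simp add: q_def)
    qed
    have fq: "[f (i + int q) = f i + t] (mod int N)" for i using fg[of i] q[of i] by simp
    have mult: "[f (int (k * q)) = f 0 + int k * t] (mod int N)" for k
    proof (induction k)
      case (Suc k)
      have "[f (int (k * q) + int q) = f (int (k * q)) + t] (mod int N)" by (rule fq)
      also have "[f (int (k * q)) + t = f 0 + int k * t + t] (mod int N)"
        using Suc by (intro cong_add) auto
      finally show ?case by (simp add: algebra_simps)
    qed simp
    have "[f (int (2 ^ j * q)) = f 0] (mod int N)"
      using mult[of "2 ^ j"] tN by (simp add: cong_def)
    then have "int l dvd int (2 ^ j * q)" using inj[of _ 0] feq[of _ 0] by simp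
    then obtain u where u: "2 ^ j * q = u * l" by (metis dvdE int_dvd_int_iff mult.commute)
    \<comment> \<open>If \<open>u\<close> were even, half of the 2^j rotations would already return
      to the start, although they translate by N / 2.\<close>
    have "odd u"
    proof
      assume "even u"
      then obtain v where "u = 2 * v" by blast
      then have "2 ^ j' * q = v * l" using u j' by simp
      then have "f (int (2 ^ j' * q)) = f 0" using feq by simp
      then have "int N dvd 2 ^ j' * t" using mult[of "2 ^ j'"]
        by (simp add: cong_iff_dvd_diff)
      then have "int N dvd int N div 2" using half_t by simp
      moreover have "0 < int N div 2" "int N div 2 < int N" using N by auto
      ultimately show False using zdvd_not_zless by blast
    qed
    \<comment> \<open>N is even, so the reduction modulo N in a translation does not disturb the
      parity of a step.\<close>
    have wq: "w (i + q) = w i" for i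
    proof -
      have "[x = y] (mod 2)" if "[x = y] (mod int N)" for x y :: int
        using that N(1) by (meson cong_dvd_modulus even_of_nat)
      then have "[f (int (Suc i) + int q) - f (int i + int q) = f (int (Suc i)) + t - (f (int i) + t)] (mod 2)"
        using fq by (intro cong_diff) auto
      then have "[f (int (Suc (i + q))) - f (int (i + q)) = f (int (Suc i)) - f (int i)] (mod 2)"
        by (simp add: add.commute add.left_commute)
      then have "even (f (int (Suc (i + q))) - f (int (i + q))) \<longleftrightarrow> even (f (int (Suc i)) - f (int i))"
        by (rule cong_dvd_iff)
      then show ?thesis unfolding w_def by (simp only:)
    qed
    have wl: "w (i + l) = w i" for i
    proof -
      have "f (int (i + l)) = f (int i)" "f (int (Suc (i + l))) = f (int (Suc i))"
        using feq by auto
      then show ?thesis unfolding w_def by metis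
    qed
    define R where "R = (\<Sum>i<q. w i)"
    have "2 ^ j * R = (\<Sum>i<2 ^ j * q. w i)"
      using sum_periodic[of w q "2 ^ j", OF wq] by (simp add: R_def)
    also have "\<dots> = int u * S" unfolding u S_def using sum_periodic[of w l u, OF wl] .
    finally have RS: "2 ^ j * R = int u * S" .
    then have "2 ^ j dvd int u * S" by (metis dvd_triv_left)
    moreover have "coprime (2 ^ j) (int u)" using \<open>odd u\<close> by simp
    ultimately have "2 ^ j dvd S" by (simp add: coprime_dvd_mult_right_iff)
    then obtain S' where S': "S = 2 ^ j * S'" by blast
    have "R = int u * S'" using RS S' by simp
    then have "even R \<longleftrightarrow> even S'" using \<open>odd u\<close> by simp
    moreover have "even R \<longleftrightarrow> even t"
    proof -
      have "[f (int q) = f 0 + t] (mod 2)"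
        using fq[of 0] N(1) by (metis add_0 cong_dvd_modulus even_of_nat)
      then have "even (f (int q) - f 0) \<longleftrightarrow> even t"
        by (auto simp: cong_iff_dvd_diff)
      then show ?thesis using parity[of q] unfolding R_def
        by (metis cong_dvd_iff)
    qed
    ultimately have "2 dvd S' - t" by simp
    then have "2 ^ j * 2 dvd 2 ^ j * (S' - t)" by (rule mult_dvd_mono[OF dvd_refl])
    then show ?thesis unfolding card using S' tN
      by (simp add: cong_iff_dvd_diff algebra_simps)
  qed
qed

section \<open>Translations acting on edges\<close>

lemma cycle_edges_map:
  assumes "c \<noteq> []"
  shows "cycle_edges (map h c) = (\<lambda>e. h ` e) ` cycle_edges c"
proof -
  have "{map h c ! i, map h c ! (Suc i mod length c)} = h ` {c ! i, c ! (Suc i mod length c)}"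
    if "i < length c" for i
    using that assms by (simp add: nth_map)
  then show ?thesis unfolding cycle_edges_def by (simp, blast)
qed

lemma translate_translate: "translate N t (translate N u e) = translate N (u + t) e"
  by (simp add: translate_def image_image mod_add_left_eq add.assoc)

lemma translate_eq_self:
  assumes "e \<subseteq> {0..<int N}" "int N dvd t"
  shows "translate N t e = e"
proof -
  obtain k where "t = int N * k" using assms(2) by blast
  then have "(x + t) mod int N = x" if "x \<in> e" for x
    using that assms(1) by auto
  then show ?thesis by (simp add: translate_def)
qed

lemma inj_on_translate: "inj_on (translate N t) (Pow {0..<int N})"
proof (rule inj_on_inverseI)
  show "translate N (- t) (translate N t e) = e" if "e \<in> Pow {0..<int N}" for e
    using that by (simp add: translate_translate translate_eq_self)
qed

text \<open>Reduction modulo an even N keeps parities. The two images must also stay distinct, since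
  a sum over a set counts coinciding elements once.\<close>

lemma odd_sum_translate:
  assumes "even N" "x \<in> {0..<int N}" "y \<in> {0..<int N}" "x \<noteq> y"
  shows "odd (\<Sum>(translate N t {x, y})) \<longleftrightarrow> odd (\<Sum>{x, y})"
proof -
  have "(x + t) mod int N \<noteq> (y + t) mod int N"
  proof
    assume "(x + t) mod int N = (y + t) mod int N"
    then have "[x + t = y + t] (mod int N)" by (simp add: cong_def)
    then have "[x = y] (mod int N)" by (simp only: cong_add_rcancel)
    then show False using assms by (simp add: cong_def)
  qed
  moreover have "even (z mod int N) \<longleftrightarrow> even z" for z
    using assms(1) by (simp add: dvd_mod_iff)
  ultimately show ?thesis using assms(4) by (auto simp: translate_def)
qed

lemma multipartite_edgeD:
  assumes "{x, y} \<in> multipartite_edges m n"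
  shows "x \<in> {0..<int (m * n)}" "y \<in> {0..<int (m * n)}" "\<not> int m dvd x - y" "x \<noteq> y"
proof -
  obtain x' y' where "{x, y} = {x', y'}" "x' \<in> {0..<int (m * n)}" "y' \<in> {0..<int (m * n)}"
    "\<not> int m dvd x' - y'"
    using assms unfolding multipartite_edges_def multipartite_verts_def by blast
  then show "x \<in> {0..<int (m * n)}" "y \<in> {0..<int (m * n)}" "\<not> int m dvd x - y" "x \<noteq> y"
    by (auto simp: doubleton_eq_iff dvd_diff_commute)
qed

lemma multipartite_edges_subset: "multipartite_edges m n \<subseteq> Pow {0..<int (m * n)}"
  unfolding multipartite_edges_def multipartite_verts_def by auto

lemma finite_multipartite_edges: "finite (multipartite_edges m n)"
  using multipartite_edges_subset by (rule finite_subset) simp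

text \<open>Makes the weight of the orbit argument constant along orbits.\<close>

lemma card_odd_edges_translate:
  assumes "even n" "B \<subseteq> multipartite_edges m n"
  shows "card (odd_edges (translate (m * n) t ` B)) = card (odd_edges B)"
proof -
  have "odd (\<Sum>(translate (m * n) t e)) \<longleftrightarrow> odd (\<Sum>e)" if eB: "e \<in> B" for e
  proof -
    obtain x y where "e = {x, y}"
      using eB assms(2) unfolding multipartite_edges_def by blast
    moreover from this have "{x, y} \<in> multipartite_edges m n" using eB assms(2) by blast
    ultimately show ?thesis
      using odd_sum_translate[of "m * n" x y t] multipartite_edgeD[of x y m n] assms(1) by simp
  qed
  then have "odd_edges (translate (m * n) t ` B) = translate (m * n) t ` odd_edges B"
    unfolding odd_edges_def by auto
  moreover have "inj_on (translate (m * n) t) (odd_edges B)"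
    using assms(2) multipartite_edges_subset[of m n]
    by (intro inj_on_subset[OF inj_on_translate]) (auto simp: odd_edges_def)
  ultimately show ?thesis by (simp add: card_image)
qed

section \<open>Counting edges and odd edges by differences\<close>

text \<open>By symmetry and irreflexivity every fibre of (x, y) -> {x, y} on \<open>R\<close> has
  exactly two elements.\<close>

lemma card_doubletons:
  assumes "finite R" "sym R" "irrefl R"
  shows "card R = 2 * card {{x, y} | x y. (x, y) \<in> R}"
proof -
  let ?f = "\<lambda>(x, y). {x, y}"
  have im: "{{x, y} | x y. (x, y) \<in> R} = ?f ` R" by auto
  have "card {p \<in> R. ?f p = e} = 2" if eR: "e \<in> ?f ` R" for e
  proof -
    obtain x y where e: "e = {x, y}" "(x, y) \<in> R" using eR by auto
    then have "x \<noteq> y" "(y, x) \<in> R" using assms(2,3) by (auto simp: irrefl_def dest: symD)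
    then have "{p \<in> R. ?f p = e} = {(x, y), (y, x)}" using e by (auto simp: doubleton_eq_iff)
    then show ?thesis using \<open>x \<noteq> y\<close> by simp
  qed
  moreover have "card R = (\<Sum>e\<in>?f ` R. card {p \<in> R. ?f p = e})"
    using sum.image_gen[OF assms(1), of "\<lambda>_. 1 :: nat" ?f] by simp
  ultimately show ?thesis unfolding im by simp
qed

text \<open>For fixed \<open>x\<close> the map y -> (x - y) mod N is an involution of the residues,
  so it matches the admissible \<open>y\<close> with the admissible differences.\<close>

lemma card_pairs_difference:
  fixes P :: "int \<Rightarrow> bool" and N :: nat
  assumes per: "\<And>d. P (d mod int N) \<longleftrightarrow> P d"
  shows "card {(x, y). x \<in> {0..<int N} \<and> y \<in> {0..<int N} \<and> P (x - y)} =
    N * card {d \<in> {0..<int N}. P d}"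
proof -
  have "card {y \<in> {0..<int N}. P (x - y)} = card {d \<in> {0..<int N}. P d}"
    if "x \<in> {0..<int N}" for x
  proof -
    let ?g = "\<lambda>y. (x - y) mod int N"
    have g: "?g (?g y) = y" if "y \<in> {0..<int N}" for y
      using that by (simp add: mod_diff_right_eq)
    have r: "?g y \<in> {0..<int N}" for y using that by auto
    have "\<forall>y\<in>{y \<in> {0..<int N}. P (x - y)}. ?g (?g y) = y" using g by blast
    moreover have "\<forall>d\<in>{d \<in> {0..<int N}. P d}. ?g (?g d) = d" using g by blast
    moreover have "?g ` {y \<in> {0..<int N}. P (x - y)} \<subseteq> {d \<in> {0..<int N}. P d}"
      using r per by blast
    moreover have "?g ` {d \<in> {0..<int N}. P d} \<subseteq> {y \<in> {0..<int N}. P (x - y)}"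
    proof
      fix y assume "y \<in> ?g ` {d \<in> {0..<int N}. P d}"
      then obtain d where d: "d \<in> {0..<int N}" "P d" "y = ?g d" by blast
      then have "P ((x - y) mod int N)" using g by simp
      then show "y \<in> {y \<in> {0..<int N}. P (x - y)}" using per r d(3) by blast
    qed
    ultimately show ?thesis by (intro bij_betw_same_card[OF bij_betw_byWitness])
  qed
  then have "(\<Sum>x\<in>{0..<int N}. card {y \<in> {0..<int N}. P (x - y)}) =
      N * card {d \<in> {0..<int N}. P d}"
    using sum.cong[OF refl, of "{0..<int N}" "\<lambda>x. card {y \<in> {0..<int N}. P (x - y)}"
      "\<lambda>_. card {d \<in> {0..<int N}. P d}"] by simp
  moreover have "{(x, y). x \<in> {0..<int N} \<and> y \<in> {0..<int N} \<and> P (x - y)} =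
      (SIGMA x:{0..<int N}. {y \<in> {0..<int N}. P (x - y)})" by auto
  moreover have "card (SIGMA x:{0..<int N}. {y \<in> {0..<int N}. P (x - y)}) =
      (\<Sum>x\<in>{0..<int N}. card {y \<in> {0..<int N}. P (x - y)})"
    by (rule card_SigmaI) (auto intro: finite_subset[of _ "{0..<int N}"])
  ultimately show ?thesis by (simp only:)
qed

lemma card_edges_difference:
  fixes P :: "int \<Rightarrow> bool" and N :: nat
  assumes "\<And>d. P (d mod int N) \<longleftrightarrow> P d" "\<And>d. P (- d) \<longleftrightarrow> P d" "\<not> P 0"
  shows "2 * card {{x, y} | x y. x \<in> {0..<int N} \<and> y \<in> {0..<int N} \<and> P (x - y)} =
    N * card {d \<in> {0..<int N}. P d}"
proof -
  let ?R = "{(x, y). x \<in> {0..<int N} \<and> y \<in> {0..<int N} \<and> P (x - y)}"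
  have "finite ?R" by (rule finite_subset[of _ "{0..<int N} \<times> {0..<int N}"]) auto
  moreover have "P (y - x)" if "P (x - y)" for x y
    using that assms(2)[of "x - y"] by simp
  then have "sym ?R" by (auto simp: sym_def)
  moreover have "irrefl ?R" using assms(3) by (auto simp: irrefl_def)
  ultimately show ?thesis using card_doubletons[of ?R] card_pairs_difference[of P N] assms(1) by simp
qed

lemma multiples_atLeastLessThan:
  assumes "m > 0"
  shows "{d \<in> {0..<int (m * n)}. int m dvd d} = (\<lambda>k. int m * k) ` {0..<int n}"
proof (intro equalityI subsetI)
  fix d assume "d \<in> {d \<in> {0..<int (m * n)}. int m dvd d}"
  then obtain k where k: "d = int m * k" "0 \<le> int m * k" "int m * k < int m * int n"
    by (auto elim: dvdE)
  then have "k \<in> {0..<int n}" using assms by (simp add: zero_le_mult_iff)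
  then show "d \<in> (\<lambda>k. int m * k) ` {0..<int n}" using k(1) by blast
qed (use assms in auto)

lemma card_odd_atLeastLessThan:
  assumes "even n"
  shows "2 * card {k \<in> {0..<int n}. odd k} = n"
proof -
  obtain h where h: "n = 2 * h" using assms by blast
  have "{k \<in> {0..<int n}. odd k} = (\<lambda>k. 2 * k + 1) ` {0..<int h}"
  proof (intro equalityI subsetI)
    fix d assume d: "d \<in> {k \<in> {0..<int n}. odd k}"
    then obtain k where "d = 2 * k + 1" by (blast elim: oddE)
    then show "d \<in> (\<lambda>k. 2 * k + 1) ` {0..<int h}" using d h by auto
  qed (use h in auto)
  then show ?thesis using h by (simp add: card_image inj_on_def)
qed

text \<open>The admissible differences are the mn residues without the n multiples of
  \<open>m\<close>.\<close>

lemma card_multipartite_edges: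
  assumes "m \<ge> 2"
  shows "2 * card (multipartite_edges m n) = m * n * ((m - 1) * n)"
proof -
  have m: "m > 0" using assms by simp
  have "int m dvd d mod int (m * n) \<longleftrightarrow> int m dvd d" for d by (simp add: dvd_mod_iff)
  then have edges: "2 * card (multipartite_edges m n) =
      m * n * card {d \<in> {0..<int (m * n)}. \<not> int m dvd d}"
    using card_edges_difference[of "\<lambda>d. \<not> int m dvd d" "m * n"]
    unfolding multipartite_edges_def multipartite_verts_def by simp
  let ?V = "{0..<int (m * n)}" and ?M = "{d \<in> {0..<int (m * n)}. int m dvd d}"
  have "{d \<in> ?V. \<not> int m dvd d} = ?V - ?M" by blast
  moreover have "card (?V - ?M) = card ?V - card ?M"
    by (rule card_Diff_subset) (auto intro: finite_subset[of _ ?V])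
  moreover have "card ?M = n"
    unfolding multiples_atLeastLessThan[OF m] using m by (simp add: card_image inj_on_def)
  moreover have "card ?V = m * n" by (simp only: card_atLeastLessThan_int diff_zero nat_int)
  ultimately have "card {d \<in> ?V. \<not> int m dvd d} = (m - 1) * n"
    by (simp only: diff_mult_distrib mult_1)
  then show ?thesis using edges by (simp only:)
qed

text \<open>Turns the parity of an edge's sum into a condition on its difference, the form that
  \<open>card_edges_difference\<close> counts.\<close>

lemma odd_edges_multipartite:
  "odd_edges (multipartite_edges m n) =
    {{x, y} | x y. x \<in> {0..<int (m * n)} \<and> y \<in> {0..<int (m * n)} \<and> (\<not> int m dvd x - y \<and> odd (x - y))}"
    (is "_ = ?R")
proof -
  have *: "odd (\<Sum>{x, y}) \<longleftrightarrow> odd (x - y)" if "\<not> int m dvd x - y" for x y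
    using that by (cases "x = y") auto
  show ?thesis
  proof (intro equalityI subsetI)
    fix e assume e: "e \<in> odd_edges (multipartite_edges m n)"
    then obtain x y where xy: "e = {x, y}" "x \<in> {0..<int (m * n)}" "y \<in> {0..<int (m * n)}"
      "\<not> int m dvd x - y"
      unfolding odd_edges_def multipartite_edges_def multipartite_verts_def by blast
    moreover have "odd (x - y)" using e *[OF xy(4)] unfolding odd_edges_def xy(1) by simp
    ultimately show "e \<in> ?R" by blast
  next
    fix e assume "e \<in> ?R"
    then obtain x y where xy: "e = {x, y}" "x \<in> {0..<int (m * n)}" "y \<in> {0..<int (m * n)}"
      "\<not> int m dvd x - y" "odd (x - y)" by blast
    then have "e \<in> multipartite_edges m n"
      unfolding multipartite_edges_def multipartite_verts_def by blast
    moreover have "odd (\<Sum>e)" unfolding xy(1) using xy(5) *[OF xy(4)] by simp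
    ultimately show "e \<in> odd_edges (multipartite_edges m n)" by (simp add: odd_edges_def)
  qed
qed

text \<open>Half of the mn residues are odd. From these the odd multiples of \<open>m\<close> drop
  out: none for even \<open>m\<close>, n / 2 of them for odd \<open>m\<close>. The factor 4 avoids
  division.\<close>

lemma card_odd_edges_multipartite:
  assumes "m > 0" "even n"
  shows "4 * card (odd_edges (multipartite_edges m n)) =
    m * n * (if even m then m * n else (m - 1) * n)"
proof -
  let ?D = "{d \<in> {0..<int (m * n)}. \<not> int m dvd d \<and> odd d}"
  let ?M = "{d \<in> {0..<int (m * n)}. int m dvd d \<and> odd d}"
  have per: "int m dvd d mod int (m * n) \<longleftrightarrow> int m dvd d"
    "even (d mod int (m * n)) \<longleftrightarrow> even d" for d
    using assms(2) by (simp_all add: dvd_mod_iff)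
  have E: "2 * card (odd_edges (multipartite_edges m n)) = m * n * card ?D"
    using card_edges_difference[of "\<lambda>d. \<not> int m dvd d \<and> odd d" "m * n"] per
    unfolding odd_edges_multipartite by simp
  have M: "2 * card ?M = (if even m then 0 else n)"
  proof (cases "even m")
    case True
    then have "?M = {}" using dvd_trans[of 2 "int m"] by auto
    then show ?thesis using True by (simp only: card.empty if_True mult_0_right)
  next
    case False
    have "?M = {d \<in> (\<lambda>k. int m * k) ` {0..<int n}. odd d}"
      unfolding multiples_atLeastLessThan[OF assms(1), symmetric] by blast
    also have "\<dots> = (\<lambda>k. int m * k) ` {k \<in> {0..<int n}. odd k}" using False by auto
    finally have "card ?M = card {k \<in> {0..<int n}. odd k}"
      using assms(1) by (simp add: card_image inj_on_def)
    then show ?thesis using False card_odd_atLeastLessThan[OF assms(2)] by simp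
  qed
  have "2 * card {d \<in> {0..<int (m * n)}. odd d} = m * n"
    using assms(2) by (intro card_odd_atLeastLessThan) simp
  moreover have "card {d \<in> {0..<int (m * n)}. odd d} = card ?D + card ?M"
  proof -
    have "{d \<in> {0..<int (m * n)}. odd d} = ?D \<union> ?M" by auto
    moreover have "card (?D \<union> ?M) = card ?D + card ?M"
      by (rule card_Un_disjoint) (auto intro: finite_subset[of _ "{0..<int (m * n)}"])
    ultimately show ?thesis by (simp only:)
  qed
  ultimately have "2 * card ?D + 2 * card ?M = m * n" by simp
  then have "2 * card ?D = (if even m then m * n else (m - 1) * n)"
    using M by (auto simp: diff_mult_distrib)
  moreover have "4 * card (odd_edges (multipartite_edges m n)) = m * n * (2 * card ?D)"
    using E by linarith
  ultimately show ?thesis by (simp only:)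
qed

section \<open>The congruence for cyclic systems\<close>

text \<open>Translation by \<open>s\<close>, the odd part of N, generates the translations of
  2-power order. The orbit lemma is applied to it with the weight \<open>w\<close>, whose sum over
  the system is the total number of odd edges minus 2^a times the number of cycles.\<close>

lemma cyclic_system_odd_edges_cong:
  assumes sys: "cyclic_cycle_system l m n \<C>" and "m \<ge> 2" "n > 0" "even n"
  shows "[int (card (odd_edges (multipartite_edges m n))) =
      2 ^ multiplicity 2 (m * n) * int (card \<C>)] (mod 2 ^ (multiplicity 2 (m * n) + 1))"
proof -
  define N where "N = m * n"
  define a where "a = multiplicity 2 N"
  define E where "E = multipartite_edges m n"
  define T where "T t B = translate N t ` B" for t and B :: "int set set"
  define w where "w B = int (card (odd_edges B)) - 2 ^ a" for B
  have N: "even N" "N > 0" using assms by (auto simp: N_def)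
  obtain s where s: "N = 2 ^ a * s" "odd s"
    using N multiplicity_decompose'[of N 2] unfolding a_def by auto
  have part: "\<Union>\<C> = E" "disjoint \<C>"
    and cyc: "\<And>B. B \<in> \<C> \<Longrightarrow> \<exists>c. cycle_seq c \<and> length c = l \<and> B = cycle_edges c"
    and shift: "\<And>c. cycle_seq c \<Longrightarrow> cycle_edges c \<in> \<C> \<Longrightarrow>
      cycle_edges (map (\<lambda>x. (x + 1) mod int N) c) \<in> \<C>"
    using sys unfolding cyclic_cycle_system_def cycle_system_def partition_on_def E_def N_def by auto
  have BE: "B \<subseteq> E" if "B \<in> \<C>" for B using that part by blast
  have EV: "e \<subseteq> {0..<int N}" if "e \<in> E" for e
    using that multipartite_edges_subset unfolding E_def N_def by blast
  have finE: "finite E" unfolding E_def by (rule finite_multipartite_edges)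
  then have fin: "finite \<C>" using part(1) finite_UnionD by blast
  have T0: "T t B = B" if "B \<in> \<C>" "int N dvd t" for t B
  proof -
    have "translate N t e = e" if "e \<in> B" for e
      using EV BE[OF \<open>B \<in> \<C>\<close>] that \<open>int N dvd t\<close> by (intro translate_eq_self) auto
    then show ?thesis by (simp add: T_def)
  qed
  have TT: "T t (T u B) = T (u + t) B" for t u B
    unfolding T_def by (simp add: image_image translate_translate)
  have T1: "T 1 B \<in> \<C>" if "B \<in> \<C>" for B
  proof -
    obtain c where c: "cycle_seq c" "B = cycle_edges c" using cyc[OF \<open>B \<in> \<C>\<close>] by blast
    then have "c \<noteq> []" by (auto simp: cycle_seq_def)
    then have "T 1 B = cycle_edges (map (\<lambda>x. (x + 1) mod int N) c)"
      unfolding c(2) T_def translate_def by (simp add: cycle_edges_map)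
    then show ?thesis using shift c \<open>B \<in> \<C>\<close> by simp
  qed
  have TC: "T (int k) B \<in> \<C>" if "B \<in> \<C>" for k B
  proof (induction k)
    case (Suc k)
    then have "T 1 (T (int k) B) \<in> \<C>" by (rule T1)
    then show ?case by (simp add: TT add.commute)
  qed (use that T0 in simp)
  have pow: "(T (int s) ^^ k) B = T (int (k * s)) B" if "B \<in> \<C>" for k B
    by (induction k) (simp_all add: T0 that TT add.commute)
  have "2 ^ (a + 1) dvd sum w \<C>"
  proof (rule two_power_dvd_sum_orbits[where \<phi> = "T (int s)"])
    fix B assume B: "B \<in> \<C>"
    show "(T (int s) ^^ 2 ^ a) B = B"
      using pow[OF B, of "2 ^ a"] T0[OF B, of "int N"] s(1) by simp
    show "w (T (int s) B) = w B"
      unfolding w_def T_def N_def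
      using card_odd_edges_translate[OF \<open>even n\<close>, of B m] BE[OF B] by (simp add: E_def)
    fix i assume i: "i \<le> a" "(T (int s) ^^ 2 ^ i) B = B"
    obtain c where c: "cycle_seq c" "B = cycle_edges c" using cyc[OF B] by blast
    \<comment> \<open>The cycle is fixed by the translation by 2^i s = N / 2^(a - i), so
      \<open>translate_fixed_cycle_cong\<close> applies with j = a - i.\<close>
    have Ns: "N = 2 ^ (a - i) * (2 ^ i * s)"
      using s(1) i(1) by (simp flip: mult.assoc power_add)
    have "set c \<subseteq> {0..<int N}"
    proof
      fix x assume "x \<in> set c"
      then obtain k where k: "k < length c" "x = c ! k" by (auto simp: in_set_conv_nth)
      then have "{x, c ! (Suc k mod length c)} \<in> cycle_edges c"
        unfolding cycle_edges_def by blast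
      then show "x \<in> {0..<int N}" using EV BE[OF B] c(2) by blast
    qed
    moreover have "\<not> [x - y = int N div 2] (mod int N)" if "{x, y} \<in> cycle_edges c" for x y
    proof
      assume xy: "[x - y = int N div 2] (mod int N)"
      obtain h where "n = 2 * h" using \<open>even n\<close> by blast
      then have "int N div 2 = int m * int h" "int m dvd int N" unfolding N_def by auto
      then have "[x - y = int m * int h] (mod int m)"
        using xy cong_dvd_modulus by metis
      then have "int m dvd x - y" using cong_dvd_iff by force
      moreover have "{x, y} \<in> multipartite_edges m n" using that BE[OF B] c(2) E_def by blast
      ultimately show False using multipartite_edgeD(3) by blast
    qed
    moreover have "translate N (int (N div 2 ^ (a - i))) ` cycle_edges c \<subseteq> cycle_edges c"
    proof -
      have "N div 2 ^ (a - i) = 2 ^ i * s" using Ns by simp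
      then show ?thesis using pow[OF B, of "2 ^ i"] i(2) unfolding T_def c(2) by simp
    qed
    ultimately have "[int (card (odd_edges B)) = int N] (mod 2 ^ (a - i + 1))"
      unfolding c(2) using c(1) N Ns by (intro translate_fixed_cycle_cong) auto
    \<comment> \<open>As \<open>s\<close> is odd, 2^a s agrees with 2^a modulo 2^(a + 1), hence
      modulo the given smaller or equal power.\<close>
    moreover have "[int N = 2 ^ a] (mod 2 ^ (a - i + 1))"
    proof -
      have "int N - 2 ^ a = 2 ^ a * (int s - 1)" using s(1) by (simp add: algebra_simps)
      moreover have "2 ^ a * 2 dvd 2 ^ a * (int s - 1)"
        using s(2) by (intro mult_dvd_mono) auto
      then have "2 ^ (a + 1) dvd 2 ^ a * (int s - 1)" by (simp add: mult.commute)
      moreover have "(2 :: int) ^ (a - i + 1) dvd 2 ^ (a + 1)" by (rule le_imp_power_dvd) simp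
      ultimately show ?thesis unfolding cong_iff_dvd_diff by (metis dvd_trans)
    qed
    ultimately have "[int (card (odd_edges B)) = 2 ^ a] (mod 2 ^ (a - i + 1))"
      by (rule cong_trans)
    then show "2 ^ (a - i + 1) dvd w B" unfolding w_def by (simp only: cong_iff_dvd_diff)
  qed (use fin TC in auto)
  moreover have "odd_edges E = (\<Union>B\<in>\<C>. odd_edges B)"
    unfolding part(1)[symmetric] odd_edges_def by blast
  then have "card (odd_edges E) = (\<Sum>B\<in>\<C>. card (odd_edges B))"
    using fin part(2) finite_subset[OF BE finE]
    by (simp, intro card_UN_disjoint) (auto simp: odd_edges_def disjoint_def)
  ultimately have "2 ^ (a + 1) dvd int (card (odd_edges E)) - 2 ^ a * int (card \<C>)"
    unfolding w_def by (simp add: sum_subtractf mult.commute)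
  then show ?thesis unfolding cong_iff_dvd_diff a_def N_def E_def .
qed

section \<open>Number of cycles and its parity\<close>

lemma cycle_system_card:
  assumes "cycle_system l E \<C>" "finite E"
  shows "card E = l * card \<C>"
proof -
  have part: "partition_on E \<C>"
    and cyc: "\<And>B. B \<in> \<C> \<Longrightarrow> \<exists>c. cycle_seq c \<and> length c = l \<and> B = cycle_edges c"
    using assms(1) unfolding cycle_system_def by auto
  have "card B = l" if "B \<in> \<C>" for B using cyc[OF that] card_cycle_edges by blast
  moreover have "card E = (\<Sum>B\<in>\<C>. card B)"
  proof -
    have "\<Union>\<C> = E" "pairwise disjnt \<C>"
      using part unfolding partition_on_def disjoint_def pairwise_def disjnt_def by auto
    moreover from this have "finite B" if "B \<in> \<C>" for B
      using that assms(2) by (meson Union_upper finite_subset)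
    ultimately show ?thesis using card_Union_disjoint[of \<C>] by simp
  qed
  ultimately show ?thesis by simp
qed

text \<open>The total number of odd edges is mn q = 2^a s q. Dividing the congruence by 2^a and
  dropping the odd factor \<open>s\<close> leaves a comparison of parities.\<close>

lemma cyclic_system_parity:
  assumes sys: "cyclic_cycle_system l m n \<C>" and "m \<ge> 2" "n > 0" "even n"
    and q: "4 * q = (if even m then m * n else (m - 1) * n)"
  shows "even (card \<C>) \<longleftrightarrow> even q"
proof -
  let ?a = "multiplicity 2 (m * n)"
  have "m * n > 0" using assms by simp
  then obtain s where s: "m * n = 2 ^ ?a * s" "odd s"
    using multiplicity_decompose'[of "m * n" 2] by auto
  have "4 * card (odd_edges (multipartite_edges m n)) = m * n * (4 * q)"
    unfolding q using assms by (intro card_odd_edges_multipartite) auto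
  then have "card (odd_edges (multipartite_edges m n)) = 2 ^ ?a * (s * q)"
    using s(1) by (simp add: algebra_simps)
  then have "[2 ^ ?a * int (s * q) = 2 ^ ?a * int (card \<C>)] (mod 2 ^ ?a * 2)"
    using cyclic_system_odd_edges_cong[OF assms(1-4)] by (simp add: mult.commute)
  then have "[int (s * q) = int (card \<C>)] (mod 2)"
    by (simp add: cong_iff_dvd_diff flip: right_diff_distrib)
  then have "even (s * q) \<longleftrightarrow> even (card \<C>)"
    by (metis cong_dvd_iff even_of_nat)
  then show ?thesis using s(2) by simp
qed

section \<open>The four cases by 2-adic valuation\<close>

theorem theorem3p3:
  fixes m n l :: nat
  assumes "m \<ge> 2" and "n > 0" and "even n"
    and "([m = 0] (mod 4) \<and>
            multiplicity 2 l = multiplicity 2 m + 2 * multiplicity 2 n - 1) \<or>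
         ([m = 1] (mod 4) \<and>
            multiplicity 2 l = multiplicity 2 (m - 1) + 2 * multiplicity 2 n - 1) \<or>
         (([m = 2] (mod 4) \<or> [m = 3] (mod 4)) \<and> [n = 2] (mod 4) \<and> \<not> [l = 0] (mod 4)) \<or>
         (([m = 2] (mod 4) \<or> [m = 3] (mod 4)) \<and> [n = 0] (mod 4) \<and>
            multiplicity 2 l = 2 * multiplicity 2 n)"
  shows "\<not> (\<exists>\<C>. cyclic_cycle_system l m n \<C>)"
proof
  assume "\<exists>\<C>. cyclic_cycle_system l m n \<C>"
  then obtain \<C> where sys: "cyclic_cycle_system l m n \<C>" by blast
  let ?v = "multiplicity (2 :: nat)"
  have "card (multipartite_edges m n) = l * card \<C>"
    using sys finite_multipartite_edges unfolding cyclic_cycle_system_def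
    by (intro cycle_system_card) auto
  then have count: "2 * (l * card \<C>) = m * (m - 1) * (n * n)"
    using card_multipartite_edges[OF assms(1), of n] by (simp add: algebra_simps)
  have pos: "m * (m - 1) * (n * n) > 0" using assms by simp
  \<comment> \<open>\<open>multiplicity\<close> takes the default value 0 at 0, so additivity of
    valuations needs nonzero factors.\<close>
  have ne: "l \<noteq> 0" "card \<C> \<noteq> 0"
    using pos unfolding count[symmetric] by auto
  have "?v (2 * (l * card \<C>)) = 1 + (?v l + ?v (card \<C>))"
    using ne by (simp add: prime_elem_multiplicity_mult_distrib)
  moreover have "?v (m * (m - 1) * (n * n)) = ?v m + ?v (m - 1) + 2 * ?v n"
    using assms by (simp add: prime_elem_multiplicity_mult_distrib)
  \<comment> \<open>In each case this equation decides whether the number of cycles is even;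
    \<open>parity\<close> then contradicts it.\<close>
  ultimately have val: "1 + ?v l + ?v (card \<C>) = ?v m + ?v (m - 1) + 2 * ?v n"
    using count by simp
  \<comment> \<open>Ensures that the subtraction of 1 in cases (a) and (b) does not
    truncate.\<close>
  have vn: "?v n \<ge> 1" using assms by (intro multiplicity_geI) auto
  have odd0: "?v k = 0" if "odd k" for k using that by (rule not_dvd_imp_multiplicity_0)
  have twice0: "?v k = 1" if "k mod 4 = 2" for k
  proof (rule multiplicity_eqI)
    have "2 dvd k" "\<not> 4 dvd k" using that by presburger+
    then show "2 ^ 1 dvd k" "\<not> 2 ^ Suc 1 dvd k" by auto
  qed
  have odd_card: "odd (card \<C>)" if "?v (card \<C>) = 0"
  proof
    assume "even (card \<C>)"
    then have "?v (card \<C>) \<ge> 1" using ne(2) by (intro multiplicity_geI) auto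
    then show False using that by simp
  qed
  have even_card: "even (card \<C>)" if "?v (card \<C>) > 0"
    using that odd0[of "card \<C>"] by fastforce
  obtain k where k: "n = 2 * k" using assms(3) by blast
  have nk: "n mod 4 = 2 * (k mod 2)" using mod_mult_mult1[of 2 k 2] k by simp
  define h where "h = m div 4"
  have h: "m = 4 * h + m mod 4" by (simp add: h_def)
  note parity = cyclic_system_parity[OF sys assms(1-3)]
  have m23: "?v m + ?v (m - 1) = 1" "even (card \<C>) \<longleftrightarrow> even k"
    if "m mod 4 = 2 \<or> m mod 4 = 3"
  proof -
    \<comment> \<open>Both residues give the same q: mn/4 for m = 4h + 2 and (m - 1)n/4 for m = 4h +
      3 equal (2h + 1)k, which has the parity of \<open>k\<close>.\<close>
    have "?v m + ?v (m - 1) = 1 \<and> (even (card \<C>) \<longleftrightarrow> even ((2 * h + 1) * k))"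
      using that
    proof
      assume m: "m mod 4 = 2"
      then have "m = 4 * h + 2" using h by simp
      then have "even m" "odd (m - 1)" by auto
      then have "?v m + ?v (m - 1) = 1" using twice0[OF m] odd0[of "m - 1"] by simp
      moreover have "even (card \<C>) \<longleftrightarrow> even ((2 * h + 1) * k)"
        using \<open>m = 4 * h + 2\<close> k by (intro parity) simp
      ultimately show ?thesis by blast
    next
      assume "m mod 4 = 3"
      then have m: "m = 4 * h + 3" using h by simp
      then have "odd m" "m - 1 = 2 + 4 * h" by auto
      moreover have "(2 + 4 * h) mod 4 = 2" unfolding mod_mult_self2 by simp
      ultimately have "?v m + ?v (m - 1) = 1" using twice0[of "2 + 4 * h"] odd0[of m] by simp
      moreover have "even (card \<C>) \<longleftrightarrow> even ((2 * h + 1) * k)"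
        using m k by (intro parity) simp
      ultimately show ?thesis by blast
    qed
    then show "?v m + ?v (m - 1) = 1" "even (card \<C>) \<longleftrightarrow> even k" by auto
  qed
  have mod4: "[x = 0] (mod 4) \<longleftrightarrow> x mod 4 = 0" "[x = 1] (mod 4) \<longleftrightarrow> x mod 4 = 1"
    "[x = 2] (mod 4) \<longleftrightarrow> x mod 4 = 2" "[x = 3] (mod 4) \<longleftrightarrow> x mod 4 = 3" for x :: nat
    by (simp_all add: cong_def)
  consider (a) "m mod 4 = 0" "?v l = ?v m + 2 * ?v n - 1"
    | (b) "m mod 4 = 1" "?v l = ?v (m - 1) + 2 * ?v n - 1"
    | (c) "m mod 4 = 2 \<or> m mod 4 = 3" "n mod 4 = 2" "l mod 4 \<noteq> 0"
    | (d) "m mod 4 = 2 \<or> m mod 4 = 3" "n mod 4 = 0" "?v l = 2 * ?v n"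
    using assms(4) unfolding mod4 by argo
  then show False
  proof cases
    \<comment> \<open>The prescribed valuation of \<open>l\<close> makes the number of cycles odd,
      while q = mn/4 = 2hk is even.\<close>
    case a
    then have m: "m = 4 * h" using h by simp
    then have "odd (m - 1)" using assms(1) by (cases h) auto
    then have "?v (card \<C>) = 0" using a(2) val vn odd0[of "m - 1"] by linarith
    then have "odd (card \<C>)" by (rule odd_card)
    moreover have "even (card \<C>) \<longleftrightarrow> even (2 * h * k)" using m k by (intro parity) simp
    then have "even (card \<C>)" by simp
    ultimately show False by blast
  next
    \<comment> \<open>The same clash, now with q = (m - 1)n/4 = 2hk.\<close>
    case b
    then have m: "m = 4 * h + 1" using h by simp
    then have "odd m" by simp
    then have "?v (card \<C>) = 0" using b(2) val vn odd0[of m] by linarith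
    then have "odd (card \<C>)" by (rule odd_card)
    moreover have "even (card \<C>) \<longleftrightarrow> even (2 * h * k)" using m k by (intro parity) simp
    then have "even (card \<C>)" by simp
    ultimately show False by blast
  next
    \<comment> \<open>Here the clash is reversed: \<open>n\<close> has valuation 1 and
      \<open>l\<close> at most 1, which forces an even number of cycles, whereas k = n / 2 is
      odd.\<close>
    case c
    have "?v l \<le> 1"
    proof (rule ccontr)
      assume "\<not> ?v l \<le> 1"
      then have "2 ^ 2 dvd l" by (intro multiplicity_dvd') auto
      then show False using c(3) by (simp add: mod_eq_0_iff_dvd)
    qed
    moreover have "?v n = 1" using c(2) by (rule twice0)
    ultimately have "?v (card \<C>) > 0" using val m23(1)[OF c(1)] by linarith
    then have "even (card \<C>)" by (rule even_card)
    moreover have "odd k" using c(2) nk by (auto elim: evenE)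
    ultimately show False using m23(2)[OF c(1)] by blast
  next
    \<comment> \<open>The valuations force an odd number of cycles, but \<open>k\<close> is
      even.\<close>
    case d
    have "?v (card \<C>) = 0" using val d(3) m23(1)[OF d(1)] by linarith
    then have "odd (card \<C>)" by (rule odd_card)
    moreover have "even k" using d(2) nk by (simp add: even_iff_mod_2_eq_zero)
    ultimately show False using m23(2)[OF d(1)] by blast
  qed
qed

end
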